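(* Let $\mathrm{A}$ be a complex $3$-dimensional $\mathfrak{perm}$ algebra. Then $\mathrm{A}$ is isomorphic to one of the following algebras from the list in the context: $\mathrm{A}_{01},\dots,\mathrm{A}_{11}$, $\mathrm{A}_{12}$, $\mathrm{A}_{13}$, $\mathrm{A}_{14}^{\alpha}$ ($\alpha\in\mathbb{C}$, $\alpha\neq 0$), $\mathrm{A}_{16}$, $\mathrm{A}_{18}$, $\mathrm{A}_{21}$, $\mathrm{A}_{24}$.
   Context: A $\mathfrak{perm}$ algebra is an associative algebra (not necessarily unital) satisfying $abc=acb$ for all $a,b,c$. The algebras below are given in a basis $e_1,e_2,e_3$. For $\mathrm{A}_{01},\dots,\mathrm{A}_{11}$ the multiplication is commutative, and products neither listed nor obtained from listed ones by commutativity are zero; for the others all products not listed are zero. $\mathrm{A}_{01}$: $e_1e_1=e_1$, $e_2e_2=e_2$; $\mathrm{A}_{02}$: $e_1e_1=e_1$, $e_1e_2=e_2$; $\mathrm{A}_{03}$: $e_1e_1=e_1$; $\mathrm{A}_{04}$: $e_1e_1=e_2$; $\mathrm{A}_{05}$: $e_1e_2=e_3$; $\mathrm{A}_{06}$: $e_1e_1=e_2$, $e_1e_2=e_3$; $\mathrm{A}_{07}$: $e_1e_1=e_1$, $e_2e_2=e_2$, $e_3e_3=e_3$; $\mathrm{A}_{08}$: $e_1e_1=e_1$, $e_2e_2=e_2$, $e_2e_3=e_3$; $\mathrm{A}_{09}$: $e_1e_1=e_1$, $e_1e_2=e_2$, $e_1e_3=e_3$; $\mathrm{A}_{10}$: $e_1e_1=e_1$,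 $e_1e_2=e_2$, $e_1e_3=e_3$, $e_2e_2=e_3$; $\mathrm{A}_{11}$: $e_1e_1=e_1$, $e_2e_2=e_3$; $\mathrm{A}_{12}$: $e_1e_2=e_3$, $e_2e_1=-e_3$; $\mathrm{A}_{13}$: $e_1e_1=e_2$, $e_1e_3=e_2$, $e_3e_1=-e_2$; $\mathrm{A}_{14}^{\alpha}$: $e_1e_2=(1+\alpha)e_3$, $e_2e_1=(1-\alpha)e_3$; $\mathrm{A}_{16}$: $e_1e_1=e_1$, $e_1e_3=e_3$, $e_2e_1=e_2$, $e_3e_1=e_3$; $\mathrm{A}_{18}$: $e_1e_1=e_1$, $e_2e_1=e_2$, $e_3e_1=e_3$; $\mathrm{A}_{21}$: $e_1e_1=e_1$, $e_2e_1=e_2$; $\mathrm{A}_{24}$: $e_1e_1=e_1$, $e_2e_2=e_2$, $e_3e_1=e_3$.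
   Formalization: The algebra is additionally assumed to have a nonzero product, since the 3-dimensional algebra with zero multiplication is perm but isomorphic to none of the listed algebras. *)

theory Defs
  imports "HOL-Analysis.Analysis"
begin

text \<open>Algebras over a field, not necessarily associative or unital.\<close>

locale algebra_over = vector_space scale
  for scale :: "'k::field \<Rightarrow> 'a::ab_group_add \<Rightarrow> 'a" +
  fixes mul :: "'a \<Rightarrow> 'a \<Rightarrow> 'a"
  assumes mul_add_left: "mul (x + y) z = mul x z + mul y z"
    and mul_add_right: "mul x (y + z) = mul x y + mul x z"
    and mul_scale_left: "mul (scale c x) y = scale c (mul x y)"
    and mul_scale_right: "mul x (scale c y) = scale c (mul x y)"

locale perm_algebra = algebra_over scale mul
  for scale :: "'k::field \<Rightarrow> 'a::ab_group_add \<Rightarrow> 'a" and mul :: "'a \<Rightarrow> 'a \<Rightarrow> 'a" +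
  assumes mul_assoc: "mul (mul a b) c = mul a (mul b c)"
    and mul_perm: "mul (mul a b) c = mul (mul a c) b"

definition algebra_isomorphic ::
  "('k::field \<Rightarrow> 'a::ab_group_add \<Rightarrow> 'a) \<Rightarrow> ('a \<Rightarrow> 'a \<Rightarrow> 'a) \<Rightarrow>
   ('k \<Rightarrow> 'b::ab_group_add \<Rightarrow> 'b) \<Rightarrow> ('b \<Rightarrow> 'b \<Rightarrow> 'b) \<Rightarrow> bool" where
  "algebra_isomorphic s m s' m' \<longleftrightarrow>
     (\<exists>f. Vector_Spaces.linear s s' f \<and> bij f \<and> (\<forall>x y. f (m x y) = m' (f x) (f y)))"

text \<open>
  Multiplications on \<open>complex ^ 3\<close> given by products of basis vectors: an entry \<open>(i, j, v)\<close>
  stands for \<open>e i \<cdot> e j = v\<close>, and products of basis vectors that do not occur are zero.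
  The index type \<open>3\<close> has the three elements \<open>1\<close>, \<open>2\<close>, \<open>3\<close> (where \<open>3 = 0\<close>).
\<close>

abbreviation e :: "3 \<Rightarrow> complex ^ 3" where
  "e i \<equiv> axis i 1"

definition mul_table :: "(3 \<times> 3 \<times> (complex ^ 3)) list \<Rightarrow> complex ^ 3 \<Rightarrow> complex ^ 3 \<Rightarrow> complex ^ 3" where
  "mul_table ps x y = (\<Sum>(i, j, v) \<leftarrow> ps. (x $ i * y $ j) *s v)"

text \<open>The commutative variant adds \<open>e j \<cdot> e i = v\<close> for each entry \<open>(i, j, v)\<close> with \<open>i \<noteq> j\<close>.\<close>

definition comm_table :: "(3 \<times> 3 \<times> (complex ^ 3)) list \<Rightarrow> complex ^ 3 \<Rightarrow> complex ^ 3 \<Rightarrow> complex ^ 3" where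
  "comm_table ps = mul_table (ps @ [(j, i, v). (i, j, v) \<leftarrow> ps, i \<noteq> j])"

definition "A01 = comm_table [(1, 1, e 1), (2, 2, e 2)]"
definition "A02 = comm_table [(1, 1, e 1), (1, 2, e 2)]"
definition "A03 = comm_table [(1, 1, e 1)]"
definition "A04 = comm_table [(1, 1, e 2)]"
definition "A05 = comm_table [(1, 2, e 3)]"
definition "A06 = comm_table [(1, 1, e 2), (1, 2, e 3)]"
definition "A07 = comm_table [(1, 1, e 1), (2, 2, e 2), (3, 3, e 3)]"
definition "A08 = comm_table [(1, 1, e 1), (2, 2, e 2), (2, 3, e 3)]"
definition "A09 = comm_table [(1, 1, e 1), (1, 2, e 2), (1, 3, e 3)]"
definition "A10 = comm_table [(1, 1, e 1), (1, 2, e 2), (1, 3, e 3), (2, 2, e 3)]"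
definition "A11 = comm_table [(1, 1, e 1), (2, 2, e 3)]"

definition "A12 = mul_table [(1, 2, e 3), (2, 1, - e 3)]"
definition "A13 = mul_table [(1, 1, e 2), (1, 3, e 2), (3, 1, - e 2)]"
definition "A14 \<alpha> = mul_table [(1, 2, (1 + \<alpha>) *s e 3), (2, 1, (1 - \<alpha>) *s e 3)]"
definition "A16 = mul_table [(1, 1, e 1), (1, 3, e 3), (2, 1, e 2), (3, 1, e 3)]"
definition "A18 = mul_table [(1, 1, e 1), (2, 1, e 2), (3, 1, e 3)]"
definition "A21 = mul_table [(1, 1, e 1), (2, 1, e 2)]"
definition "A24 = mul_table [(1, 1, e 1), (2, 2, e 2), (3, 1, e 3)]"

end

theory Submission
  imports Defs "HOL-Computational_Algebra.Fundamental_Theorem_Algebra"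
begin

text \<open>
  An element is either nilpotent or generates a subalgebra containing a non-zero idempotent.

  An idempotent \<open>i\<close> satisfies \<open>i x i = i x\<close> in a perm algebra, so
  \<open>x = i x + (x i - i x) + (x - x i)\<close> splits the algebra into the three Peirce parts on which left
  and right multiplication by \<open>i\<close> act as \<open>(1, 1)\<close>, \<open>(0, 1)\<close> and \<open>(0, 0)\<close>. With two orthogonal
  idempotents there is room for one further basis vector, and its joint Peirce type gives \<open>A07\<close>,
  \<open>A08\<close>, \<open>A24\<close> or \<open>A01\<close>. Otherwise the \<open>(0, 0)\<close> part is nil and the \<open>(1, 1)\<close> part is local,
  and the types of the two remaining basis vectors determine the algebra.

  In a nil algebra either some \<open>x x x \<noteq> 0\<close> and the algebra is \<open>A06\<close>, or all triple products
  vanish. In the latter case the product is a bilinear form with values in the annihilator: it is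
  alternating (\<open>A12\<close>), or it is normalised by splitting off a vector with \<open>x x \<noteq> 0\<close>.
\<close>

locale perm_algebra3 = perm_algebra scale mul + finite_dimensional_vector_space scale Basis
  for scale :: "complex \<Rightarrow> 'a::ab_group_add \<Rightarrow> 'a" (infixr "\<odot>" 75)
    and mul :: "'a \<Rightarrow> 'a \<Rightarrow> 'a" (infixl "\<cdot>" 70)
    and Basis :: "'a set" +
  assumes card_Basis: "card Basis = 3"
begin

lemma mul_zero [simp]: "0 \<cdot> x = 0" "x \<cdot> 0 = 0"
  using mul_add_left[of 0 0 x] mul_add_right[of x 0 0] by simp_all

lemma mul_minus: "(- x) \<cdot> y = - (x \<cdot> y)" "x \<cdot> (- y) = - (x \<cdot> y)"
  using mul_scale_left[of "-1" x y] mul_scale_right[of x "-1" y] by simp_all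

lemma mul_diff: "(x - y) \<cdot> z = x \<cdot> z - y \<cdot> z" "z \<cdot> (x - y) = z \<cdot> x - z \<cdot> y"
  using mul_add_left[of x "-y" z] mul_add_right[of z x "-y"] by (simp_all add: mul_minus)

lemmas bilinear = mul_add_left mul_add_right mul_scale_left mul_scale_right mul_minus mul_diff

text \<open>Rewriting with these facts brings a product into the left-normed form in which all
  factors but the first are sorted.\<close>

lemmas normed = mul_assoc[symmetric] mul_perm

subsection \<open>Bases and isomorphisms\<close>

definition comb :: "'a \<Rightarrow> 'a \<Rightarrow> 'a \<Rightarrow> complex \<Rightarrow> complex \<Rightarrow> complex \<Rightarrow> 'a" where
  "comb u v w a b c = a \<odot> u + b \<odot> v + c \<odot> w"

text \<open>Independence of the triple rather than of the set: repeated vectors are excluded, and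
  any relation yields all its coefficients at once.\<close>

definition indep3 :: "'a \<Rightarrow> 'a \<Rightarrow> 'a \<Rightarrow> bool" where
  "indep3 u v w \<longleftrightarrow> (\<forall>a b c. comb u v w a b c = 0 \<longrightarrow> a = 0 \<and> b = 0 \<and> c = 0)"

lemma indep3I:
  assumes "\<And>a b c. a \<odot> u + b \<odot> v + c \<odot> w = 0 \<Longrightarrow> a = 0 \<and> b = 0 \<and> c = 0"
  shows "indep3 u v w"
  using assms by (auto simp: indep3_def comb_def)

lemma indep3D:
  assumes "indep3 u v w" "a \<odot> u + b \<odot> v + c \<odot> w = 0"
  shows "a = 0" "b = 0" "c = 0"
  using assms by (auto simp: indep3_def comb_def)

lemma indep3_nonzero:
  assumes "indep3 u v w"
  shows "u \<noteq> 0" "v \<noteq> 0" "w \<noteq> 0"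
  using indep3D[OF assms, of 1 0 0] indep3D[OF assms, of 0 1 0] indep3D[OF assms, of 0 0 1] by auto

lemma indep3_swap12:
  assumes "indep3 u v w"
  shows "indep3 v u w"
proof (rule indep3I)
  fix a b c assume "a \<odot> v + b \<odot> u + c \<odot> w = 0"
  then have "b \<odot> u + a \<odot> v + c \<odot> w = 0" by (simp add: ac_simps)
  from indep3D[OF assms this] show "a = 0 \<and> b = 0 \<and> c = 0" by simp
qed

lemma indep3_swap23:
  assumes "indep3 u v w"
  shows "indep3 u w v"
proof (rule indep3I)
  fix a b c assume "a \<odot> u + b \<odot> w + c \<odot> v = 0"
  then have "a \<odot> u + c \<odot> v + b \<odot> w = 0" by (simp add: ac_simps)
  from indep3D[OF assms this] show "a = 0 \<and> b = 0 \<and> c = 0" by simp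
qed

lemma comb_eq_iff:
  assumes "indep3 u v w"
  shows "comb u v w a b c = comb u v w a' b' c' \<longleftrightarrow> a = a' \<and> b = b' \<and> c = c'"
proof
  assume "comb u v w a b c = comb u v w a' b' c'"
  then have "comb u v w (a - a') (b - b') (c - c') = 0"
    by (simp add: comb_def bilinear algebra_simps)
  then show "a = a' \<and> b = b' \<and> c = c'"
    using assms unfolding indep3_def by fastforce
qed simp

text \<open>Adding \<open>w\<close>, \<open>v\<close>, \<open>u\<close> in turn shows that the set
  is independent with exactly three elements, which is the dimension.\<close>

lemma indep3_span:
  assumes "indep3 u v w"
  shows "span {u, v, w} = UNIV"
proof -
  have comb0: "comb u v w a b c = 0 \<longleftrightarrow> a = 0 \<and> b = 0 \<and> c = 0" for a b c
    using assms by (auto simp: indep3_def comb_def)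
  have "w \<noteq> 0" using comb0[of 0 0 1] by (auto simp: comb_def)
  moreover have "v \<notin> span {w}"
    using comb0[of 0 1 "- k" for k] by (auto simp: comb_def span_singleton)
  moreover have "u \<notin> span {v, w}"
    using comb0[of 1 "- k" "- l" for k l]
    by (auto simp: comb_def span_insert[of v] span_singleton algebra_simps)
  ultimately have ind: "independent {u, v, w}" "card {u, v, w} = 3"
    by (auto simp: independent_insert card_insert_if span_base)
  show ?thesis
    using card_ge_dim_independent[OF subset_UNIV ind(1)] ind(2) by (auto simp: dim_UNIV card_Basis)
qed

lemma indep3_expand:
  assumes "indep3 u v w"
  obtains a b c where "x = a \<odot> u + b \<odot> v + c \<odot> w"
proof -
  have "x \<in> span {u, v, w}" using indep3_span[OF assms] by simp
  then obtain a b c where "x - a \<odot> u - b \<odot> v = c \<odot> w"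
    by (auto simp: span_insert span_singleton)
  then have "x = a \<odot> u + b \<odot> v + c \<odot> w" by (simp add: algebra_simps)
  then show thesis by (rule that)
qed

section \<open>Choosing basis vectors inside a spanning set\<close>

text \<open>Otherwise fewer than three vectors would span the space. Choosing from a given
  \<open>H\<close> later allows basis vectors to be Peirce homogeneous; the scalar form lets a
  relation kill the coefficient of \<open>w\<close>.\<close>

lemma exists_notin_span:
  assumes "span H = UNIV" "finite S" "card S < 3"
  shows "\<exists>w\<in>H. \<forall>c. c \<odot> w \<in> span S \<longrightarrow> c = 0"
proof -
  have "\<exists>w\<in>H. w \<notin> span S"
  proof (rule ccontr)
    assume "\<not> ?thesis"
    then have "span H \<subseteq> span S" by (intro span_minimal) (auto simp: subspace_span)
    then have "UNIV \<subseteq> span S" using assms(1) by simp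
    then have "dim (UNIV :: 'a set) \<le> card S" using assms(2) by (intro dim_le_card) auto
    then show False using card_Basis assms(3) by (simp add: dim_UNIV)
  qed
  then obtain w where w: "w \<in> H" "w \<notin> span S" by auto
  have "c = 0" if "c \<odot> w \<in> span S" for c
    using span_scale[OF that, of "inverse c"] w by (cases "c = 0") auto
  then show ?thesis using w by auto
qed

lemma exists_indep2:
  assumes "span H = UNIV" "u \<noteq> 0"
  shows "\<exists>v\<in>H. \<forall>a b. a \<odot> u + b \<odot> v = 0 \<longrightarrow> a = 0 \<and> b = 0"
proof -
  obtain v where v: "v \<in> H" "\<And>c. c \<odot> v \<in> span {u} \<Longrightarrow> c = 0"
    using exists_notin_span[OF assms(1), of "{u}"] by auto
  have "a = 0 \<and> b = 0" if *: "a \<odot> u + b \<odot> v = 0" for a b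
  proof -
    have "b \<odot> v = - (a \<odot> u)" using * by (subst eq_neg_iff_add_eq_0) (simp add: ac_simps)
    then have "b \<odot> v \<in> span {u}" by (simp only:) (intro span_neg span_scale span_base; simp)
    then have "b = 0" by (rule v(2))
    then show ?thesis using * assms(2) by auto
  qed
  then show ?thesis using v(1) by blast
qed

lemma exists_indep3:
  assumes "span H = UNIV" "\<And>a b. a \<odot> u + b \<odot> v = 0 \<Longrightarrow> a = 0 \<and> b = 0"
  shows "\<exists>w\<in>H. indep3 u v w"
proof -
  have "card {u, v} < 3" by (simp add: card_insert_if)
  then obtain w where w: "w \<in> H" "\<And>c. c \<odot> w \<in> span {u, v} \<Longrightarrow> c = 0"
    using exists_notin_span[OF assms(1), of "{u, v}"] by auto
  have "a = 0 \<and> b = 0 \<and> c = 0" if *: "a \<odot> u + b \<odot> v + c \<odot> w = 0" for a b c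
  proof -
    have "c \<odot> w = - (a \<odot> u + b \<odot> v)" using *
      by (subst eq_neg_iff_add_eq_0) (simp add: ac_simps)
    then have "c \<odot> w \<in> span {u, v}"
      by (simp only:) (intro span_neg span_add span_scale span_base; simp)
    then have "c = 0" by (rule w(2))
    then show ?thesis using * assms(2) by auto
  qed
  then show ?thesis using w(1) indep3I by blast
qed

section \<open>Coordinates and the isomorphism with a model\<close>

definition coord :: "'a \<Rightarrow> 'a \<Rightarrow> 'a \<Rightarrow> complex ^ 3 \<Rightarrow> 'a" where
  "coord u v w x = comb u v w (x $ 1) (x $ 2) (x $ 3)"

text \<open>\<open>coord u v w\<close> is a linear multiplicative bijection out of the model; the
  isomorphism wanted goes into the model, so its inverse is taken.\<close>

lemma isomorphicI:
  assumes "indep3 u v w" "\<And>x y. coord u v w x \<cdot> coord u v w y = coord u v w (B x y)"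
  shows "algebra_isomorphic scale mul (*s) B"
proof -
  define F where "F = coord u v w"
  have lin: "F (x + y) = F x + F y" "F (c *s x) = c \<odot> F x" for x y c
    by (simp_all add: F_def coord_def comb_def bilinear algebra_simps)
  have inj: "inj F"
    by (auto simp: inj_def F_def coord_def comb_eq_iff[OF assms(1)] vec_eq_iff forall_3)
  have "\<exists>x. y = F x" for y
  proof -
    obtain a b c where "y = a \<odot> u + b \<odot> v + c \<odot> w" by (rule indep3_expand[OF assms(1)])
    then have "y = F (vector [a, b, c])" by (simp add: F_def coord_def comb_def)
    then show ?thesis by blast
  qed
  then have bij: "bij F" using inj by (auto simp: bij_def)
  let ?G = "inv F"
  have GF: "?G (F x) = x" and FG: "F (?G y) = y" for x y
    using bij by (simp_all add: bij_def inv_f_f surj_f_inv_f)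
  have Ga: "?G (x + y) = ?G x + ?G y" for x y
    using GF[of "?G x + ?G y"] by (simp only: lin FG)
  have Gs: "?G (c \<odot> x) = c *s ?G x" for x c
    using GF[of "c *s ?G x"] by (simp only: lin FG)
  have "Vector_Spaces.linear scale (*s) ?G"
    by (simp add: Vector_Spaces.linear_iff vector_space_axioms vec.vector_space_axioms Ga Gs)
  moreover have "?G (x \<cdot> y) = B (?G x) (?G y)" for x y
    using assms(2)[of "?G x" "?G y"] GF[of "B (?G x) (?G y)"]
    unfolding F_def[symmetric] by (simp add: FG)
  ultimately show ?thesis
    unfolding algebra_isomorphic_def using bij bij_imp_bij_inv by blast
qed

text \<open>The common goal of all cases. Having a name for it allows its negation to be assumed,
  which excludes pairs of orthogonal nonzero idempotents.\<close>

definition classified :: bool where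
  "classified \<longleftrightarrow> (\<exists>B \<in> {A01, A02, A03, A04, A05, A06, A07, A08, A09, A10, A11, A12, A13} \<union>
              {A14 \<alpha> | \<alpha>. \<alpha> \<noteq> 0} \<union> {A16, A18, A21, A24}. algebra_isomorphic scale mul (*s) B)"

lemma classifiedI:
  assumes "B \<in> {A01, A02, A03, A04, A05, A06, A07, A08, A09, A10, A11, A12, A13} \<union>
              {A14 \<alpha> | \<alpha>. \<alpha> \<noteq> 0} \<union> {A16, A18, A21, A24}"
    and "indep3 u v w" "\<And>x y. coord u v w x \<cdot> coord u v w y = coord u v w (B x y)"
  shows classified
  using assms(1) isomorphicI[OF assms(2,3)] unfolding classified_def by blast

lemmas table = coord_def comb_def mul_table_def comm_table_def axis_def bilinear algebra_simps
  A01_def A02_def A03_def A04_def A05_def A06_def A07_def A08_def A09_def A10_def A11_def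
  A12_def A13_def A14_def A16_def A18_def A21_def A24_def

section \<open>Recognising each model from its nine basis products\<close>

lemma classified_A01:
  assumes "indep3 u v w"
    and p: "u \<cdot> u = u" "u \<cdot> v = 0" "u \<cdot> w = 0"
      "v \<cdot> u = 0" "v \<cdot> v = v" "v \<cdot> w = 0"
      "w \<cdot> u = 0" "w \<cdot> v = 0" "w \<cdot> w = 0"
  shows classified
  by (rule classifiedI[of A01, OF _ assms(1)]) (simp_all add: table p)

lemma classified_A02:
  assumes "indep3 u v w"
    and p: "u \<cdot> u = u" "u \<cdot> v = v" "u \<cdot> w = 0"
      "v \<cdot> u = v" "v \<cdot> v = 0" "v \<cdot> w = 0"
      "w \<cdot> u = 0" "w \<cdot> v = 0" "w \<cdot> w = 0"
  shows classified
  by (rule classifiedI[of A02, OF _ assms(1)]) (simp_all add: table p)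

lemma classified_A03:
  assumes "indep3 u v w"
    and p: "u \<cdot> u = u" "u \<cdot> v = 0" "u \<cdot> w = 0"
      "v \<cdot> u = 0" "v \<cdot> v = 0" "v \<cdot> w = 0"
      "w \<cdot> u = 0" "w \<cdot> v = 0" "w \<cdot> w = 0"
  shows classified
  by (rule classifiedI[of A03, OF _ assms(1)]) (simp_all add: table p)

lemma classified_A04:
  assumes "indep3 u v w"
    and p: "u \<cdot> u = v" "u \<cdot> v = 0" "u \<cdot> w = 0"
      "v \<cdot> u = 0" "v \<cdot> v = 0" "v \<cdot> w = 0"
      "w \<cdot> u = 0" "w \<cdot> v = 0" "w \<cdot> w = 0"
  shows classified
  by (rule classifiedI[of A04, OF _ assms(1)]) (simp_all add: table p)

lemma classified_A05:
  assumes "indep3 u v w"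
    and p: "u \<cdot> u = 0" "u \<cdot> v = w" "u \<cdot> w = 0"
      "v \<cdot> u = w" "v \<cdot> v = 0" "v \<cdot> w = 0"
      "w \<cdot> u = 0" "w \<cdot> v = 0" "w \<cdot> w = 0"
  shows classified
  by (rule classifiedI[of A05, OF _ assms(1)]) (simp_all add: table p)

lemma classified_A06:
  assumes "indep3 u v w"
    and p: "u \<cdot> u = v" "u \<cdot> v = w" "u \<cdot> w = 0"
      "v \<cdot> u = w" "v \<cdot> v = 0" "v \<cdot> w = 0"
      "w \<cdot> u = 0" "w \<cdot> v = 0" "w \<cdot> w = 0"
  shows classified
  by (rule classifiedI[of A06, OF _ assms(1)]) (simp_all add: table p)

lemma classified_A07:
  assumes "indep3 u v w"
    and p: "u \<cdot> u = u" "u \<cdot> v = 0" "u \<cdot> w = 0"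
      "v \<cdot> u = 0" "v \<cdot> v = v" "v \<cdot> w = 0"
      "w \<cdot> u = 0" "w \<cdot> v = 0" "w \<cdot> w = w"
  shows classified
  by (rule classifiedI[of A07, OF _ assms(1)]) (simp_all add: table p)

lemma classified_A08:
  assumes "indep3 u v w"
    and p: "u \<cdot> u = u" "u \<cdot> v = 0" "u \<cdot> w = 0"
      "v \<cdot> u = 0" "v \<cdot> v = v" "v \<cdot> w = w"
      "w \<cdot> u = 0" "w \<cdot> v = w" "w \<cdot> w = 0"
  shows classified
  by (rule classifiedI[of A08, OF _ assms(1)]) (simp_all add: table p)

lemma classified_A09:
  assumes "indep3 u v w"
    and p: "u \<cdot> u = u" "u \<cdot> v = v" "u \<cdot> w = w"
      "v \<cdot> u = v" "v \<cdot> v = 0" "v \<cdot> w = 0"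
      "w \<cdot> u = w" "w \<cdot> v = 0" "w \<cdot> w = 0"
  shows classified
  by (rule classifiedI[of A09, OF _ assms(1)]) (simp_all add: table p)

lemma classified_A10:
  assumes "indep3 u v w"
    and p: "u \<cdot> u = u" "u \<cdot> v = v" "u \<cdot> w = w"
      "v \<cdot> u = v" "v \<cdot> v = w" "v \<cdot> w = 0"
      "w \<cdot> u = w" "w \<cdot> v = 0" "w \<cdot> w = 0"
  shows classified
  by (rule classifiedI[of A10, OF _ assms(1)]) (simp_all add: table p)

lemma classified_A11:
  assumes "indep3 u v w"
    and p: "u \<cdot> u = u" "u \<cdot> v = 0" "u \<cdot> w = 0"
      "v \<cdot> u = 0" "v \<cdot> v = w" "v \<cdot> w = 0"
      "w \<cdot> u = 0" "w \<cdot> v = 0" "w \<cdot> w = 0"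
  shows classified
  by (rule classifiedI[of A11, OF _ assms(1)]) (simp_all add: table p)

lemma classified_A12:
  assumes "indep3 u v w"
    and p: "u \<cdot> u = 0" "u \<cdot> v = w" "u \<cdot> w = 0"
      "v \<cdot> u = - w" "v \<cdot> v = 0" "v \<cdot> w = 0"
      "w \<cdot> u = 0" "w \<cdot> v = 0" "w \<cdot> w = 0"
  shows classified
  by (rule classifiedI[of A12, OF _ assms(1)]) (simp_all add: table p)

lemma classified_A13:
  assumes "indep3 u v w"
    and p: "u \<cdot> u = v" "u \<cdot> v = 0" "u \<cdot> w = v"
      "v \<cdot> u = 0" "v \<cdot> v = 0" "v \<cdot> w = 0"
      "w \<cdot> u = - v" "w \<cdot> v = 0" "w \<cdot> w = 0"
  shows classified
  by (rule classifiedI[of A13, OF _ assms(1)]) (simp_all add: table p)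

lemma classified_A14:
  assumes "indep3 u v w"
    and p: "u \<cdot> u = 0" "u \<cdot> v = (1 + k) \<odot> w" "u \<cdot> w = 0"
      "v \<cdot> u = (1 - k) \<odot> w" "v \<cdot> v = 0" "v \<cdot> w = 0"
      "w \<cdot> u = 0" "w \<cdot> v = 0" "w \<cdot> w = 0"
    and k: "k \<noteq> 0"
  shows classified
  by (rule classifiedI[of "A14 k", OF _ assms(1)]) (use k in blast, simp add: table p)

lemma classified_A16:
  assumes "indep3 u v w"
    and p: "u \<cdot> u = u" "u \<cdot> v = 0" "u \<cdot> w = w"
      "v \<cdot> u = v" "v \<cdot> v = 0" "v \<cdot> w = 0"
      "w \<cdot> u = w" "w \<cdot> v = 0" "w \<cdot> w = 0"
  shows classified
  by (rule classifiedI[of A16, OF _ assms(1)]) (simp_all add: table p)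

lemma classified_A18:
  assumes "indep3 u v w"
    and p: "u \<cdot> u = u" "u \<cdot> v = 0" "u \<cdot> w = 0"
      "v \<cdot> u = v" "v \<cdot> v = 0" "v \<cdot> w = 0"
      "w \<cdot> u = w" "w \<cdot> v = 0" "w \<cdot> w = 0"
  shows classified
  by (rule classifiedI[of A18, OF _ assms(1)]) (simp_all add: table p)

lemma classified_A21:
  assumes "indep3 u v w"
    and p: "u \<cdot> u = u" "u \<cdot> v = 0" "u \<cdot> w = 0"
      "v \<cdot> u = v" "v \<cdot> v = 0" "v \<cdot> w = 0"
      "w \<cdot> u = 0" "w \<cdot> v = 0" "w \<cdot> w = 0"
  shows classified
  by (rule classifiedI[of A21, OF _ assms(1)]) (simp_all add: table p)

lemma classified_A24:
  assumes "indep3 u v w"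
    and p: "u \<cdot> u = u" "u \<cdot> v = 0" "u \<cdot> w = 0"
      "v \<cdot> u = 0" "v \<cdot> v = v" "v \<cdot> w = 0"
      "w \<cdot> u = w" "w \<cdot> v = 0" "w \<cdot> w = 0"
  shows classified
  by (rule classifiedI[of A24, OF _ assms(1)]) (simp_all add: table p)

subsection \<open>Idempotents\<close>

text \<open>If \<open>x\<close> is not nilpotent, its minimal polynomial yields a polynomial \<open>u\<close> in \<open>x\<close> without
  constant term such that \<open>x x x u = x x x\<close>, and a high power of \<open>u\<close> is the idempotent.\<close>

lemma nil_or_idempotent:
  "x \<cdot> x \<cdot> x \<cdot> x = 0 \<or> (\<exists>f g. f \<noteq> 0 \<and> f \<cdot> f = f \<and> f = x \<cdot> g \<and> f = g \<cdot> x)"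
proof -
  \<comment> \<open>Four powers of \<open>x\<close> in dimension 3 are linearly dependent.\<close>
  have "\<exists>a b c d. a \<odot> x + b \<odot> (x \<cdot> x) + c \<odot> (x \<cdot> x \<cdot> x) + d \<odot> (x \<cdot> x \<cdot> x \<cdot> x) = 0 \<and>
      (a \<noteq> 0 \<or> b \<noteq> 0 \<or> c \<noteq> 0 \<or> d \<noteq> 0)"
  proof (cases "indep3 x (x \<cdot> x) (x \<cdot> x \<cdot> x)")
    case True
    then obtain a b c where "x \<cdot> x \<cdot> x \<cdot> x = a \<odot> x + b \<odot> (x \<cdot> x) + c \<odot> (x \<cdot> x \<cdot> x)"
      by (rule indep3_expand)
    then show ?thesis by (intro exI[of _ a] exI[of _ b] exI[of _ c] exI[of _ "-1"]) simp
  next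
    case False
    then obtain a b c where "a \<odot> x + b \<odot> (x \<cdot> x) + c \<odot> (x \<cdot> x \<cdot> x) = 0"
      "a \<noteq> 0 \<or> b \<noteq> 0 \<or> c \<noteq> 0"
      by (auto simp: indep3_def comb_def)
    then show ?thesis by (intro exI[of _ a] exI[of _ b] exI[of _ c] exI[of _ 0]) auto
  qed
  then obtain a b c d where
    rel: "a \<odot> x + b \<odot> (x \<cdot> x) + c \<odot> (x \<cdot> x \<cdot> x) + d \<odot> (x \<cdot> x \<cdot> x \<cdot> x) = 0"
    and ne: "a \<noteq> 0 \<or> b \<noteq> 0 \<or> c \<noteq> 0 \<or> d \<noteq> 0"
    by blast
  let ?x3 = "x \<cdot> x \<cdot> x"
  show ?thesis
  proof (cases "?x3 \<cdot> x = 0")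
    case False
    \<comment> \<open>Multiplying the relation by \<open>x\<close> at most twice moves its lowest
      term to the cube of \<open>x\<close>. If \<open>a = b = 0\<close>, then \<open>c\<close>
      cannot vanish because the fourth power is nonzero.\<close>
    have "\<exists>k l m n. k \<odot> ?x3 + l \<odot> (?x3 \<cdot> x) + m \<odot> (?x3 \<cdot> x \<cdot> x) + n \<odot> (?x3 \<cdot> x \<cdot> x \<cdot> x) = 0 \<and> k \<noteq> 0"
    proof (cases "a = 0")
      case a: True
      show ?thesis
      proof (cases "b = 0")
        case b: True
        then have "c \<noteq> 0" using a ne rel False by auto
        then show ?thesis using rel a b
          by (intro exI[of _ c] exI[of _ d] exI[of _ 0]) simp
      next
        case b: False
        have "(b \<odot> (x \<cdot> x) + c \<odot> ?x3 + d \<odot> (?x3 \<cdot> x)) \<cdot> x = 0" using rel a by simp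
        then show ?thesis using b
          by (intro exI[of _ b] exI[of _ c] exI[of _ d] exI[of _ 0]) (simp add: bilinear)
      qed
    next
      case a: False
      have "(a \<odot> x + b \<odot> (x \<cdot> x) + c \<odot> ?x3 + d \<odot> (?x3 \<cdot> x)) \<cdot> x \<cdot> x = 0" using rel by simp
      then show ?thesis using a
        by (intro exI[of _ a] exI[of _ b] exI[of _ c] exI[of _ d]) (simp add: bilinear)
    qed
    then obtain k l m n where
      rel3: "k \<odot> ?x3 + (l \<odot> (?x3 \<cdot> x) + m \<odot> (?x3 \<cdot> x \<cdot> x) + n \<odot> (?x3 \<cdot> x \<cdot> x \<cdot> x)) = 0"
      and k: "k \<noteq> 0"
      by (auto simp: add.assoc)
    \<comment> \<open>Solving the relation for the cube and factoring it out on the right gives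
      \<open>?x3 \<cdot> u = ?x3\<close>.\<close>
    define p where "p = - 1 / k"
    define u where "u = (p * l) \<odot> x + (p * m) \<odot> (x \<cdot> x) + (p * n) \<odot> ?x3"
    \<comment> \<open>As \<open>u\<close> has no constant term, one factor \<open>x\<close> can be
      cancelled from \<open>u \<cdot> u\<close>; \<open>v\<close> is the quotient, so
      \<open>x \<cdot> v = u \<cdot> u\<close>.\<close>
    define v where "v = (p * l) \<odot> u + (p * m) \<odot> (x \<cdot> u) + (p * n) \<odot> (x \<cdot> x \<cdot> u)"
    have "k \<odot> ?x3 = - (l \<odot> (?x3 \<cdot> x) + m \<odot> (?x3 \<cdot> x \<cdot> x) + n \<odot> (?x3 \<cdot> x \<cdot> x \<cdot> x))"
      using rel3 by (subst eq_neg_iff_add_eq_0)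
    then have "(- p) \<odot> k \<odot> ?x3 = p \<odot> (l \<odot> (?x3 \<cdot> x) + m \<odot> (?x3 \<cdot> x \<cdot> x) + n \<odot> (?x3 \<cdot> x \<cdot> x \<cdot> x))"
      by (simp only: scale_minus_left scale_minus_right minus_minus)
    then have x3u: "?x3 \<cdot> u = ?x3"
      using k by (simp add: p_def u_def bilinear normed algebra_simps)
    have ux: "u \<cdot> x = x \<cdot> u" by (simp add: u_def bilinear normed)
    have vx: "v \<cdot> x = u \<cdot> u" "x \<cdot> v = u \<cdot> u"
      by (simp_all add: v_def u_def bilinear normed algebra_simps)
    \<comment> \<open>Six factors \<open>u\<close> are three products \<open>v \<cdot> x\<close>, so
      they contain the cube of \<open>x\<close>, which absorbs every further
      \<open>u\<close>.\<close>
    define f where "f = u \<cdot> u \<cdot> u \<cdot> u \<cdot> u \<cdot> u"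
    have "v \<cdot> v \<cdot> v \<cdot> ?x3 = v \<cdot> x \<cdot> v \<cdot> x \<cdot> v \<cdot> x" by (simp add: normed)
    also have "\<dots> = f" by (simp add: vx f_def mul_assoc)
    finally have f: "f = v \<cdot> v \<cdot> v \<cdot> ?x3" by simp
    then have fu: "f \<cdot> u = f" by (simp only: mul_assoc) (simp only: x3u mul_assoc[symmetric])
    then have "f \<cdot> f = f" by (simp only: f_def mul_assoc[symmetric])
    moreover have "f \<noteq> 0"
    proof
      assume "f = 0"
      then have "?x3 \<cdot> f = 0" by simp
      then show False using False by (simp add: f_def mul_assoc[symmetric] x3u)
    qed
    moreover have "f = x \<cdot> (v \<cdot> u \<cdot> u \<cdot> u \<cdot> u)" by (simp add: f_def mul_assoc[symmetric] vx)
    moreover have "v \<cdot> u \<cdot> u \<cdot> u \<cdot> u \<cdot> x = v \<cdot> x \<cdot> u \<cdot> u \<cdot> u \<cdot> u" by (simp only: normed)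
    then have "f = v \<cdot> u \<cdot> u \<cdot> u \<cdot> u \<cdot> x" by (simp only: f_def vx mul_assoc[symmetric])
    ultimately show ?thesis by blast
  qed simp
qed

section \<open>Quadratic elements of the unital Peirce part\<close>

lemma complete_square:
  assumes p: "i \<cdot> i = i" and v: "i \<cdot> v = v" "v \<cdot> i = v" and vv: "v \<cdot> v = a \<odot> i + b \<odot> v"
  obtains s d where "(v + s \<odot> i) \<cdot> (v + s \<odot> i) = d \<odot> i"
proof -
  define s where "s = - b / 2"
  have "(v + s \<odot> i) \<cdot> (v + s \<odot> i) = (a + s * s) \<odot> i + (b \<odot> v + (s \<odot> v + s \<odot> v))"
    by (simp add: bilinear p v vv algebra_simps)
  moreover have "b \<odot> v + (s \<odot> v + s \<odot> v) = 0"
    by (simp only: scale_left_distrib[symmetric]) (simp add: s_def)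
  ultimately show thesis using that by simp
qed

text \<open>The span of \<open>i\<close> and \<open>y\<close> is the quotient of the polynomial ring
  by \<open>y^2 - d\<close>, which splits at the two square roots of \<open>d\<close>. The
  idempotents are half of \<open>i\<close> plus or minus \<open>y\<close> divided by a root, so
  \<open>t\<close> is \<open>1 / (2 * csqrt d)\<close>.\<close>

lemma split_idempotent:
  assumes p: "i \<cdot> i = i" and y: "i \<cdot> y = y" "y \<cdot> i = y" and yy: "y \<cdot> y = d \<odot> i" and d: "d \<noteq> 0"
  obtains t g h where "t \<noteq> 0" "g = (1/2) \<odot> i + t \<odot> y" "h = (1/2) \<odot> i + (- t) \<odot> y"
    "g \<cdot> g = g" "h \<cdot> h = h" "g \<cdot> h = 0" "h \<cdot> g = 0"
proof -
  define t where "t = 1 / (2 * csqrt d)"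
  have "csqrt d * csqrt d = d" by (simp add: power2_eq_square[symmetric])
  then have t: "t \<noteq> 0" "t * (t * d) = 1 / 4" using d by (auto simp: t_def field_simps)
  define g where "g = (1/2) \<odot> i + t \<odot> y"
  define h where "h = (1/2) \<odot> i + (- t) \<odot> y"
  have "g \<cdot> g = ((1/4) \<odot> i + (1/4) \<odot> i) + ((t / 2) \<odot> y + (t / 2) \<odot> y)"
    "h \<cdot> h = ((1/4) \<odot> i + (1/4) \<odot> i) + ((- t / 2) \<odot> y + (- t / 2) \<odot> y)"
    using t by (simp_all add: g_def h_def bilinear p y yy algebra_simps)
  then have "g \<cdot> g = g" "h \<cdot> h = h"
    by (simp_all only: scale_left_distrib[symmetric]) (simp_all add: g_def h_def)
  moreover have "g \<cdot> h = 0" "h \<cdot> g = 0"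
    using t by (simp_all add: g_def h_def bilinear p y yy algebra_simps)
  ultimately show thesis using that t(1) g_def h_def by blast
qed

section \<open>Two orthogonal idempotents\<close>

text \<open>Here \<open>i\<close> is a unit for \<open>w\<close>. After completing the square,
  \<open>w\<close> either becomes nilpotent, giving \<open>A08\<close>, or splits \<open>i\<close>
  into two idempotents, giving \<open>A07\<close> together with \<open>j\<close>.\<close>

lemma two_idempotents_block:
  assumes ind: "indep3 i j w"
    and p: "i \<cdot> i = i" "j \<cdot> j = j" "i \<cdot> j = 0" "j \<cdot> i = 0"
    and w: "i \<cdot> w = w" "w \<cdot> i = w" "j \<cdot> w = 0" "w \<cdot> j = 0"
  shows classified
proof -
  obtain a b c where ww: "w \<cdot> w = a \<odot> i + b \<odot> j + c \<odot> w" by (rule indep3_expand[OF ind])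
  have "j \<cdot> (w \<cdot> w) = 0" using w(3) by (simp add: mul_assoc[symmetric])
  then have b: "b = 0" using indep3_nonzero[OF ind] by (simp add: ww bilinear p w)
  obtain s d where yy: "(w + s \<odot> i) \<cdot> (w + s \<odot> i) = d \<odot> i"
    using complete_square[OF p(1) w(1,2), of a c] ww b by auto
  define y where "y = w + s \<odot> i"
  note yy = yy[folded y_def]
  have iw: "i \<cdot> y = y" "y \<cdot> i = y" "j \<cdot> y = 0" "y \<cdot> j = 0"
    by (simp_all add: y_def bilinear p w)
  have ind': "indep3 i j y"
  proof (rule indep3I)
    fix k l m assume "k \<odot> i + l \<odot> j + m \<odot> y = 0"
    then have "(k + m * s) \<odot> i + l \<odot> j + m \<odot> w = 0"
      by (simp add: y_def algebra_simps)
    from indep3D[OF ind this] show "k = 0 \<and> l = 0 \<and> m = 0" by simp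
  qed
  show ?thesis
  proof (cases "d = 0")
    case True
    \<comment> \<open>In \<open>A08\<close> the idempotent acting on the nilpotent vector comes
      second.\<close>
    have "indep3 j i y" using ind' by (rule indep3_swap12)
    then show ?thesis by (rule classified_A08) (simp_all add: p iw yy True)
  next
    case False
    obtain t g h where t: "t \<noteq> 0" "g = (1/2) \<odot> i + t \<odot> y" "h = (1/2) \<odot> i + (- t) \<odot> y"
      and gh: "g \<cdot> g = g" "h \<cdot> h = h" "g \<cdot> h = 0" "h \<cdot> g = 0"
      by (rule split_idempotent[OF p(1) iw(1,2) yy False])
    have "indep3 g h j"
    proof (rule indep3I)
      fix k l m assume "k \<odot> g + l \<odot> h + m \<odot> j = 0"
      then have "((k + l) / 2) \<odot> i + m \<odot> j + ((k - l) * t) \<odot> y = 0"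
        by (simp add: t algebra_simps diff_divide_distrib add_divide_distrib)
      from indep3D[OF ind' this] show "k = 0 \<and> l = 0 \<and> m = 0" using t(1) by auto
    qed
    then show ?thesis
      by (rule classified_A07) (use p iw gh in \<open>simp_all add: t(2,3) bilinear\<close>)
  qed
qed

lemma two_idempotents:
  assumes nz: "i \<noteq> 0" "j \<noteq> 0" and p: "i \<cdot> i = i" "j \<cdot> j = j" "i \<cdot> j = 0" "j \<cdot> i = 0"
  shows classified
proof -
  \<comment> \<open>The five joint Peirce types. No other type occurs, since
    \<open>i \<cdot> x \<cdot> j = i \<cdot> j \<cdot> x = 0\<close> and likewise with
    \<open>i\<close> and \<open>j\<close> exchanged.\<close>
  define H where "H = {w. i \<cdot> w = w \<and> w \<cdot> i = w \<and> j \<cdot> w = 0 \<and> w \<cdot> j = 0} \<union>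
    {w. j \<cdot> w = w \<and> w \<cdot> j = w \<and> i \<cdot> w = 0 \<and> w \<cdot> i = 0} \<union>
    {w. i \<cdot> w = 0 \<and> w \<cdot> i = w \<and> j \<cdot> w = 0 \<and> w \<cdot> j = 0} \<union>
    {w. j \<cdot> w = 0 \<and> w \<cdot> j = w \<and> i \<cdot> w = 0 \<and> w \<cdot> i = 0} \<union>
    {w. i \<cdot> w = 0 \<and> w \<cdot> i = 0 \<and> j \<cdot> w = 0 \<and> w \<cdot> j = 0}"
  have "x \<in> span H" for x
  proof -
    have perms: "i \<cdot> x \<cdot> i = i \<cdot> x" "i \<cdot> x \<cdot> j = 0" "j \<cdot> x \<cdot> j = j \<cdot> x" "j \<cdot> x \<cdot> i = 0"
      using mul_perm[of i x i] mul_perm[of i x j] mul_perm[of j x j] mul_perm[of j x i]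
      by (simp_all add: p)
    have cancel: "i \<cdot> (i \<cdot> z) = i \<cdot> z" "i \<cdot> (j \<cdot> z) = 0" "j \<cdot> (j \<cdot> z) = j \<cdot> z" "j \<cdot> (i \<cdot> z) = 0"
      "z \<cdot> i \<cdot> i = z \<cdot> i" "z \<cdot> i \<cdot> j = 0" "z \<cdot> j \<cdot> j = z \<cdot> j" "z \<cdot> j \<cdot> i = 0" for z
      by (simp_all add: mul_assoc p) (simp_all add: mul_assoc[symmetric] p)
    have mid: "i \<cdot> (x \<cdot> i) = i \<cdot> x" "i \<cdot> (x \<cdot> j) = 0" "j \<cdot> (x \<cdot> j) = j \<cdot> x" "j \<cdot> (x \<cdot> i) = 0"
      using perms by (simp_all add: mul_assoc)
    have "i \<cdot> x \<in> H" "j \<cdot> x \<in> H" "x \<cdot> i - i \<cdot> x \<in> H" "x \<cdot> j - j \<cdot> x \<in> H" "x - x \<cdot> i - x \<cdot> j \<in> H"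
      by (simp_all add: H_def bilinear perms cancel mid)
    then have "i \<cdot> x + j \<cdot> x + (x \<cdot> i - i \<cdot> x) + (x \<cdot> j - j \<cdot> x) + (x - x \<cdot> i - x \<cdot> j) \<in> span H"
      by (intro span_add span_base)
    then show ?thesis by simp
  qed
  then have "span H = UNIV" by blast
  moreover have "a = 0 \<and> b = 0" if "a \<odot> i + b \<odot> j = 0" for a b
  proof -
    have "i \<cdot> (a \<odot> i + b \<odot> j) = 0" "j \<cdot> (a \<odot> i + b \<odot> j) = 0" by (simp_all add: that)
    then show ?thesis using nz by (simp add: bilinear p)
  qed
  ultimately obtain w where w: "w \<in> H" and ind: "indep3 i j w"
    using exists_indep3 by blast
  have ind': "indep3 j i w" using ind by (rule indep3_swap12)
  obtain a b c where ww: "w \<cdot> w = a \<odot> i + b \<odot> j + c \<odot> w" by (rule indep3_expand[OF ind])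
  \<comment> \<open>For type \<open>(0, 1)\<close>: \<open>w \<cdot> w = (w \<cdot> k) \<cdot> w = w
    \<cdot> (k \<cdot> w) = 0\<close>.\<close>
  have w0: "w \<cdot> w = 0" if "k \<cdot> w = 0" "w \<cdot> k = w" for k
    using that mul_assoc[of w k w] by simp
  consider "i \<cdot> w = w" "w \<cdot> i = w" "j \<cdot> w = 0" "w \<cdot> j = 0"
    | "j \<cdot> w = w" "w \<cdot> j = w" "i \<cdot> w = 0" "w \<cdot> i = 0"
    | "i \<cdot> w = 0" "w \<cdot> i = w" "j \<cdot> w = 0" "w \<cdot> j = 0"
    | "j \<cdot> w = 0" "w \<cdot> j = w" "i \<cdot> w = 0" "w \<cdot> i = 0"
    | "i \<cdot> w = 0" "w \<cdot> i = 0" "j \<cdot> w = 0" "w \<cdot> j = 0"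
    using w unfolding H_def by blast
  then show ?thesis
  proof cases
    case 1
    then show ?thesis using two_idempotents_block[OF ind] p by blast
  next
    case 2
    then show ?thesis using two_idempotents_block[OF ind'] p by blast
  next
    case 3
    show ?thesis by (rule classified_A24[OF ind]) (simp_all add: p 3 w0[OF 3(1,2)])
  next
    case 4
    show ?thesis by (rule classified_A24[OF ind']) (simp_all add: p 4 w0[OF 4(1,2)])
  next
    case 5
    have "i \<cdot> (w \<cdot> w) = 0" "j \<cdot> (w \<cdot> w) = 0" using 5 by (simp_all add: mul_assoc[symmetric])
    then have ab: "a = 0" "b = 0" using nz by (simp_all add: ww bilinear p 5)
    show ?thesis
    proof (cases "c = 0")
      case True
      show ?thesis by (rule classified_A01[OF ind]) (simp_all add: p 5 ww ab True)
    next
      case False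
      \<comment> \<open>Since \<open>w \<cdot> w = c \<odot> w\<close>, dividing \<open>w\<close> by
        \<open>c\<close> gives a third orthogonal idempotent.\<close>
      have "indep3 i j (inverse c \<odot> w)"
      proof (rule indep3I)
        fix k l m assume "k \<odot> i + l \<odot> j + m \<odot> inverse c \<odot> w = 0"
        then have "k \<odot> i + l \<odot> j + (m * inverse c) \<odot> w = 0" by simp
        from indep3D[OF ind this] show "k = 0 \<and> l = 0 \<and> m = 0" using False by simp
      qed
      then show ?thesis
        by (rule classified_A07) (use False in \<open>simp_all add: p 5 ww ab bilinear\<close>)
    qed
  qed
qed

section \<open>Nil planes and elements orthogonal to an idempotent\<close>

text \<open>\<open>M\<close> is a nil subalgebra that meets the line of \<open>i\<close> only in 0,
  so it is the plane of \<open>y\<close> and \<open>z\<close>. It serves both for the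
  \<open>(0, 0)\<close> part and for the maximal ideal of a local algebra. If some square is
  nonzero, \<open>x\<close> and its square fill the plane; otherwise all products vanish.\<close>

lemma nil_plane:
  assumes M: "\<And>x y. x \<in> M \<Longrightarrow> y \<in> M \<Longrightarrow> x + y \<in> M" "\<And>c x. x \<in> M \<Longrightarrow> c \<odot> x \<in> M"
      "\<And>x y. x \<in> M \<Longrightarrow> y \<in> M \<Longrightarrow> x \<cdot> y \<in> M"
    and nil: "\<And>x. x \<in> M \<Longrightarrow> x \<cdot> x \<cdot> x \<cdot> x = 0"
    and i: "i \<notin> M" and ind: "indep3 i y z" and yz: "y \<in> M" "z \<in> M"
  shows "(\<exists>x\<in>M. indep3 i x (x \<cdot> x) \<and> x \<cdot> x \<cdot> x = 0) \<or>
    y \<cdot> y = 0 \<and> y \<cdot> z = 0 \<and> z \<cdot> y = 0 \<and> z \<cdot> z = 0"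
proof -
  \<comment> \<open>Elements of \<open>M\<close> have no component along \<open>i\<close>.\<close>
  have i0: "a = 0" if "a \<odot> i + x \<in> M" "x \<in> M" for a x
  proof (rule ccontr)
    assume "a \<noteq> 0"
    have "inverse a \<odot> (a \<odot> i + x + (-1) \<odot> x) \<in> M" using that M(1,2) by blast
    then show False using \<open>a \<noteq> 0\<close> i by simp
  qed
  have zero: "0 \<in> M" using M(2)[OF yz(1), of 0] by simp
  show ?thesis
  proof (cases "\<exists>x\<in>M. x \<cdot> x \<noteq> 0")
    case True
    then obtain x where x: "x \<in> M" "x \<cdot> x \<noteq> 0" by blast
    note x4 = nil[OF x(1)]
    have xx: "x \<cdot> x \<in> M" "x \<cdot> x \<cdot> x \<in> M" using x M(3) by auto
    have ind': "indep3 i x (x \<cdot> x)"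
    proof (rule indep3I)
      fix a b c assume *: "a \<odot> i + b \<odot> x + c \<odot> (x \<cdot> x) = 0"
      then have "a \<odot> i + (b \<odot> x + c \<odot> (x \<cdot> x)) \<in> M" using zero by (simp add: add.assoc)
      then have a: "a = 0" using i0 M x xx by blast
      have "(b \<odot> x + c \<odot> (x \<cdot> x)) \<cdot> x \<cdot> x = 0" "(b \<odot> x + c \<odot> (x \<cdot> x)) \<cdot> x = 0" using * a by simp_all
      then have "b = 0" using x4 x(2) by (auto simp: bilinear)
      then show "a = 0 \<and> b = 0 \<and> c = 0" using * a x(2) by auto
    qed
    \<comment> \<open>Multiplying the expansion of the cube by \<open>x\<close> once and twice, with
      fourth power 0, leaves two relations between square and cube; both \<open>b = 0\<close> and
      \<open>b \<noteq> 0\<close> force the cube to vanish.\<close>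
    moreover have "x \<cdot> x \<cdot> x = 0"
    proof -
      obtain a b c where x3: "x \<cdot> x \<cdot> x = a \<odot> i + b \<odot> x + c \<odot> (x \<cdot> x)" by (rule indep3_expand[OF ind'])
      then have "a \<odot> i + (b \<odot> x + c \<odot> (x \<cdot> x)) \<in> M" using xx by (simp add: add.assoc)
      then have a: "a = 0" using i0 M x xx by blast
      have "x \<cdot> x \<cdot> x \<cdot> x \<cdot> x = b \<odot> (x \<cdot> x \<cdot> x) + c \<odot> (x \<cdot> x \<cdot> x \<cdot> x)"
        "x \<cdot> x \<cdot> x \<cdot> x = b \<odot> (x \<cdot> x) + c \<odot> (x \<cdot> x \<cdot> x)"
        using arg_cong[OF x3, of "\<lambda>t. t \<cdot> x \<cdot> x"] arg_cong[OF x3, of "\<lambda>t. t \<cdot> x"]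
        by (simp_all add: a bilinear)
      then have "b \<odot> (x \<cdot> x \<cdot> x) = 0" "b \<odot> (x \<cdot> x) + c \<odot> (x \<cdot> x \<cdot> x) = 0" using x4 by simp_all
      then show ?thesis using x3 a x(2) by (cases "b = 0") auto
    qed
    ultimately show ?thesis using x by blast
  next
    case False
    then have sq: "x \<cdot> x = 0" if "x \<in> M" for x using that by blast
    obtain a b c where yz': "y \<cdot> z = a \<odot> i + b \<odot> y + c \<odot> z" by (rule indep3_expand[OF ind])
    have "y \<cdot> z \<in> M" using M yz by blast
    then have "a \<odot> i + (b \<odot> y + c \<odot> z) \<in> M" using yz' by (simp add: add.assoc)
    then have a: "a = 0" using i0 M yz by blast
    \<comment> \<open>Multiplying by \<open>y\<close> on the left and by \<open>z\<close> on the
      right turns \<open>y \<cdot> z = b \<odot> y + c \<odot> z\<close> into equations in which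
      \<open>c\<close> and \<open>b\<close> each annihilate \<open>y \<cdot> z\<close>.\<close>
    have "y \<cdot> (y \<cdot> z) = 0" using sq yz by (simp add: mul_assoc[symmetric])
    then have 1: "c \<odot> (y \<cdot> z) = 0" using sq yz by (simp add: yz' a bilinear)
    have "(y \<cdot> z) \<cdot> z = 0" using sq yz by (simp add: mul_assoc)
    then have 2: "b \<odot> (y \<cdot> z) = 0" using sq yz by (simp add: yz' a bilinear)
    have 3: "y \<cdot> z = 0" using 1 2 yz' a by auto
    have "(y + z) \<cdot> (y + z) = 0" using sq M yz by blast
    then have "z \<cdot> y = 0" using 3 sq yz by (simp add: bilinear)
    then show ?thesis using 3 sq yz by blast
  qed
qed

text \<open>If \<open>x\<close> is not nilpotent, it yields an idempotent \<open>f\<close> divisible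
  by \<open>x\<close> on both sides; hence \<open>f\<close> is orthogonal to \<open>i\<close> on
  both sides, and the two idempotents settle the classification.\<close>

lemma orthogonal_nil:
  assumes nz: "i \<noteq> 0" and p: "i \<cdot> i = i" and x: "i \<cdot> x = 0" "x \<cdot> i = 0"
  shows "classified \<or> x \<cdot> x \<cdot> x \<cdot> x = 0"
proof (rule disjCI)
  assume "x \<cdot> x \<cdot> x \<cdot> x \<noteq> 0"
  then obtain f g where f: "f \<noteq> 0" "f \<cdot> f = f" "f = x \<cdot> g" "f = g \<cdot> x"
    using nil_or_idempotent[of x] by blast
  have "i \<cdot> f = 0" unfolding f(3) by (simp add: mul_assoc[symmetric] x)
  moreover have "f \<cdot> i = 0" unfolding f(4) by (simp add: mul_assoc x)
  ultimately show classified using two_idempotents[OF nz f(1) p f(2)] by simp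
qed

lemma nil_eigen:
  assumes "w \<cdot> w = c \<odot> w" "w \<cdot> w \<cdot> w \<cdot> w = 0"
  shows "w \<cdot> w = 0"
proof -
  have "w \<cdot> w \<cdot> w \<cdot> w = (c * c * c) \<odot> w" by (simp add: assms(1) bilinear)
  then show ?thesis using assms by auto
qed

text \<open>The square of \<open>v\<close> stays in the \<open>(1, 1)\<close> part, so it involves
  only \<open>i\<close> and \<open>v\<close>. Completing the square gives \<open>y\<close> whose
  square is \<open>d \<odot> i\<close>; a nonzero \<open>d\<close> would split \<open>i\<close> into
  two orthogonal idempotents.\<close>

lemma square_zero_shift:
  assumes nz: "i \<noteq> 0" and p: "i \<cdot> i = i" and v: "i \<cdot> v = v" "v \<cdot> i = v"
    and ind: "indep3 i v w" and w: "i \<cdot> w = 0"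
  shows "classified \<or> (\<exists>y. i \<cdot> y = y \<and> y \<cdot> i = y \<and> y \<cdot> y = 0 \<and> indep3 i y w)"
proof -
  obtain a b c where vv: "v \<cdot> v = a \<odot> i + b \<odot> v + c \<odot> w" by (rule indep3_expand[OF ind])
  have "i \<cdot> (v \<cdot> v) = v \<cdot> v" by (simp add: mul_assoc[symmetric] v)
  then have vv: "v \<cdot> v = a \<odot> i + b \<odot> v" by (simp add: vv bilinear p v w)
  obtain s d where yy: "(v + s \<odot> i) \<cdot> (v + s \<odot> i) = d \<odot> i"
    by (rule complete_square[OF p v vv])
  define y where "y = v + s \<odot> i"
  note yy = yy[folded y_def]
  have iy: "i \<cdot> y = y" "y \<cdot> i = y" by (simp_all add: y_def bilinear p v)
  have ind': "indep3 i y w"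
  proof (rule indep3I)
    fix k l m assume "k \<odot> i + l \<odot> y + m \<odot> w = 0"
    then have "(k + l * s) \<odot> i + l \<odot> v + m \<odot> w = 0"
      by (simp add: y_def algebra_simps)
    from indep3D[OF ind this] show "k = 0 \<and> l = 0 \<and> m = 0" by simp
  qed
  show ?thesis
  proof (cases "d = 0")
    case True
    then show ?thesis using ind' iy yy by auto
  next
    case False
    obtain t g h where t: "t \<noteq> 0" "g = (1/2) \<odot> i + t \<odot> y" "h = (1/2) \<odot> i + (- t) \<odot> y"
      and gh: "g \<cdot> g = g" "h \<cdot> h = h" "g \<cdot> h = 0" "h \<cdot> g = 0"
      by (rule split_idempotent[OF p iy yy False])
    have "g \<noteq> 0" "h \<noteq> 0"
      using indep3D(1)[OF ind', of "1/2" t 0] indep3D(1)[OF ind', of "1/2" "- t" 0]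
      by (auto simp: t)
    then show ?thesis using two_idempotents[OF _ _ gh] by blast
  qed
qed

section \<open>Peirce types of the two vectors beside one idempotent\<close>

text \<open>The name lists the types of \<open>v\<close> and \<open>w\<close>, with \<open>1\<close>
  for \<open>(1, 1)\<close>, \<open>01\<close> for \<open>(0, 1)\<close> and \<open>00\<close> for
  \<open>(0, 0)\<close>. The only product that needs an argument beyond shifting \<open>i\<close> is
  \<open>w \<cdot> y\<close>: it is a multiple of \<open>w\<close>, and \<open>y\<close> has square
  0.\<close>

lemma idempotent_1_01:
  assumes p: "i \<cdot> i = i" and ind: "indep3 i v w"
    and v: "i \<cdot> v = v" "v \<cdot> i = v" and w: "i \<cdot> w = 0" "w \<cdot> i = w"
  shows classified
proof (rule ccontr)
  assume nc: "\<not> classified"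
  have nz: "i \<noteq> 0" using indep3_nonzero[OF ind] by simp
  obtain y where y: "i \<cdot> y = y" "y \<cdot> i = y" "y \<cdot> y = 0" and ind': "indep3 i y w"
    using square_zero_shift[OF nz p v ind w(1)] nc by blast
  have yw: "y \<cdot> w = 0" using mul_perm[of i y w] by (simp add: y w)
  have ww: "w \<cdot> w = 0" using mul_assoc[of w i w] by (simp add: w)
  obtain a b c where wy: "w \<cdot> y = a \<odot> i + b \<odot> y + c \<odot> w" by (rule indep3_expand[OF ind'])
  have "i \<cdot> (w \<cdot> y) = 0" by (simp add: mul_assoc[symmetric] w)
  then have ab: "a \<odot> i + b \<odot> y = 0" by (simp add: wy bilinear p y w)
  then have wy: "w \<cdot> y = c \<odot> w" by (simp add: wy)
  have "w \<cdot> y \<cdot> y = 0" by (simp add: mul_assoc y)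
  then have "c = 0" using indep3_nonzero[OF ind'] by (simp add: wy bilinear)
  then have "w \<cdot> y = 0" using wy by simp
  then have classified
    by (intro classified_A16[OF indep3_swap23[OF ind']]) (simp_all add: p y w yw ww)
  then show False using nc by simp
qed

text \<open>Right multiplication by \<open>i\<close> kills the square of \<open>w\<close> but fixes
  \<open>i\<close> and \<open>v\<close>, so the square is a multiple of \<open>w\<close>, and
  nilpotency makes it 0. The condition on \<open>v\<close> covers types \<open>(1, 1)\<close> and
  \<open>(0, 1)\<close>.\<close>

lemma orthogonal_square_zero:
  assumes p: "i \<cdot> i = i" and ind: "indep3 i v w" and w: "i \<cdot> w = 0" "w \<cdot> i = 0"
    and v: "v \<cdot> i = v"
  shows "classified \<or> w \<cdot> w = 0"
proof (cases classified)
  case nc: False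
  have nz: "i \<noteq> 0" using indep3_nonzero[OF ind] by simp
  obtain a b c where ww: "w \<cdot> w = a \<odot> i + b \<odot> v + c \<odot> w" by (rule indep3_expand[OF ind])
  have "w \<cdot> w \<cdot> i = 0" by (simp add: mul_assoc w)
  then have "a \<odot> i + b \<odot> v = 0" by (simp add: ww bilinear p v w)
  then have "w \<cdot> w = c \<odot> w" by (simp add: ww)
  then show ?thesis using orthogonal_nil[OF nz p w] nc nil_eigen by blast
qed simp

lemma idempotent_1_00:
  assumes p: "i \<cdot> i = i" and ind: "indep3 i v w"
    and v: "i \<cdot> v = v" "v \<cdot> i = v" and w: "i \<cdot> w = 0" "w \<cdot> i = 0"
  shows classified
proof (rule ccontr)
  assume nc: "\<not> classified"
  have nz: "i \<noteq> 0" using indep3_nonzero[OF ind] by simp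
  obtain y where y: "i \<cdot> y = y" "y \<cdot> i = y" "y \<cdot> y = 0" and ind': "indep3 i y w"
    using square_zero_shift[OF nz p v ind w(1)] nc by blast
  have yw: "y \<cdot> w = 0" "w \<cdot> y = 0"
    using mul_assoc[of y i w] mul_assoc[of w i y] by (simp_all add: y w)
  have "w \<cdot> w = 0" using orthogonal_square_zero[OF p ind w v(2)] nc by blast
  then have classified
    by (intro classified_A02[OF ind']) (simp_all add: p y w yw)
  then show False using nc by simp
qed

lemma idempotent_01_01:
  assumes p: "i \<cdot> i = i" and ind: "indep3 i v w"
    and v: "i \<cdot> v = 0" "v \<cdot> i = v" and w: "i \<cdot> w = 0" "w \<cdot> i = w"
  shows classified
  using mul_assoc[of v i v] mul_assoc[of v i w] mul_assoc[of w i v] mul_assoc[of w i w]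
  by (intro classified_A18[OF ind]) (simp_all add: p v w)

lemma idempotent_01_00:
  assumes p: "i \<cdot> i = i" and ind: "indep3 i v w"
    and v: "i \<cdot> v = 0" "v \<cdot> i = v" and w: "i \<cdot> w = 0" "w \<cdot> i = 0"
  shows classified
proof (rule ccontr)
  assume nc: "\<not> classified"
  have "w \<cdot> w = 0" using orthogonal_square_zero[OF p ind w v(2)] nc by blast
  moreover have "w \<cdot> v = 0" using mul_perm[of w v i] mul_assoc[of w v i] by (simp add: v w)
  ultimately have classified
    using mul_assoc[of v i v] mul_assoc[of v i w]
    by (intro classified_A21[OF ind]) (simp_all add: p v w)
  then show False using nc by simp
qed

text \<open>The \<open>(0, 0)\<close> part is a subalgebra, nil by \<open>orthogonal_nil\<close>, so
  the dichotomy for nil planes separates \<open>A11\<close> from \<open>A03\<close>.\<close>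

lemma idempotent_00_00:
  assumes p: "i \<cdot> i = i" and ind: "indep3 i v w"
    and v: "i \<cdot> v = 0" "v \<cdot> i = 0" and w: "i \<cdot> w = 0" "w \<cdot> i = 0"
  shows classified
proof (rule ccontr)
  assume nc: "\<not> classified"
  have nz: "i \<noteq> 0" using indep3_nonzero[OF ind] by simp
  define M where "M = {x. i \<cdot> x = 0 \<and> x \<cdot> i = 0}"
  have assoc: "i \<cdot> (x \<cdot> y) = i \<cdot> x \<cdot> y" for x y by (simp add: mul_assoc)
  have "(\<exists>x\<in>M. indep3 i x (x \<cdot> x) \<and> x \<cdot> x \<cdot> x = 0) \<or>
    v \<cdot> v = 0 \<and> v \<cdot> w = 0 \<and> w \<cdot> v = 0 \<and> w \<cdot> w = 0"
  proof (rule nil_plane[OF _ _ _ _ _ ind])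
    show "x \<cdot> x \<cdot> x \<cdot> x = 0" if "x \<in> M" for x
      using orthogonal_nil[OF nz p] that nc by (auto simp: M_def)
    show "x \<cdot> y \<in> M" if "x \<in> M" "y \<in> M" for x y
      using that by (simp add: M_def assoc) (simp add: mul_assoc)
  qed (use v w nz in \<open>auto simp: M_def bilinear p\<close>)
  then show False
  proof
    assume "\<exists>x\<in>M. indep3 i x (x \<cdot> x) \<and> x \<cdot> x \<cdot> x = 0"
    then obtain x where x: "i \<cdot> x = 0" "x \<cdot> i = 0" "indep3 i x (x \<cdot> x)" "x \<cdot> x \<cdot> x = 0"
      by (auto simp: M_def)
    have "i \<cdot> (x \<cdot> x) = 0" "x \<cdot> x \<cdot> i = 0" "x \<cdot> (x \<cdot> x) = 0" "x \<cdot> x \<cdot> (x \<cdot> x) = 0"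
      by (simp_all add: mul_assoc[symmetric] x) (simp add: mul_assoc x)
    then have classified by (intro classified_A11[OF x(3)]) (simp_all add: p x)
    then show False using nc by simp
  next
    assume "v \<cdot> v = 0 \<and> v \<cdot> w = 0 \<and> w \<cdot> v = 0 \<and> w \<cdot> w = 0"
    then have classified by (intro classified_A03[OF ind]) (simp_all add: p v w)
    then show False using nc by simp
  qed
qed

text \<open>Here \<open>c\<close> is a root of a polynomial annihilating \<open>x\<close>, and \<open>y\<close> is the cofactor of \<open>x - c i\<close>.\<close>

lemma unital_zero_divisor:
  assumes unit: "\<And>x. i \<cdot> x = x" "\<And>x. x \<cdot> i = x" and nz: "i \<noteq> 0"
  obtains c y where "y \<noteq> 0" "(x - c \<odot> i) \<cdot> y = 0"
proof -
  have root: "\<exists>z. poly p z = 0" if "degree p > 0" for p :: "complex poly"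
    using that by (intro fundamental_theorem_of_algebra) (simp add: constant_degree)
  show thesis
  proof (cases "indep3 i x (x \<cdot> x)")
    case True
    obtain a b c where x3: "x \<cdot> (x \<cdot> x) = a \<odot> i + b \<odot> x + c \<odot> (x \<cdot> x)" by (rule indep3_expand[OF True])
    obtain r where r: "poly [:- a, - b, - c, 1:] r = 0" using root[of "[:- a, - b, - c, 1:]"] by auto
    \<comment> \<open>Quotient of \<open>t^3 - c t^2 - b t - a\<close> by \<open>t - r\<close>,
      evaluated at \<open>x\<close>.\<close>
    define y where "y = (r * r - c * r - b) \<odot> i + (r - c) \<odot> x + 1 \<odot> (x \<cdot> x)"
    have "y \<noteq> 0" using indep3D(3)[OF True] unfolding y_def by (metis zero_neq_one)
    have "a = r * (r * r - c * r - b)" using r by (simp add: algebra_simps)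
    moreover have "(x - r \<odot> i) \<cdot> y = (a - r * (r * r - c * r - b)) \<odot> i"
      unfolding y_def by (simp add: bilinear unit x3 algebra_simps)
    ultimately have "(x - r \<odot> i) \<cdot> y = 0" by simp
    then show thesis using \<open>y \<noteq> 0\<close> that by blast
  next
    case False
    then obtain a b c where rel: "a \<odot> i + b \<odot> x + c \<odot> (x \<cdot> x) = 0" and ne: "a \<noteq> 0 \<or> b \<noteq> 0 \<or> c \<noteq> 0"
      by (auto simp: indep3_def comb_def)
    have bc: "b \<noteq> 0 \<or> c \<noteq> 0" using rel ne nz by auto
    obtain r where "poly [:a, b, c:] r = 0" using root[of "[:a, b, c:]"] bc by auto
    then have r: "a = - (r * b) - r * r * c" by (simp add: algebra_simps eq_neg_iff_add_eq_0)
    \<comment> \<open>Quotient of \<open>c t^2 + b t + a\<close> by \<open>t - r\<close>, evaluated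
      at \<open>x\<close>. If it vanishes or \<open>x = r \<odot> i\<close>, then \<open>x\<close>
      is a multiple of \<open>i\<close>, and subtracting that multiple leaves 0.\<close>
    define y where "y = (b + c * r) \<odot> i + c \<odot> x"
    show thesis
    proof (cases "y = 0 \<or> x = r \<odot> i")
      case True
      have "\<exists>d. x = d \<odot> i"
      proof (cases "c = 0")
        case c: True
        then have "b \<odot> (x - r \<odot> i) = 0" using rel r by (simp add: algebra_simps)
        then show ?thesis using bc c by auto
      next
        case c: False
        from True show ?thesis
        proof
          assume "y = 0"
          then have "inverse c \<odot> ((b + c * r) \<odot> i + c \<odot> x) = 0" by (simp add: y_def)
          then have "x + (inverse c * (b + c * r)) \<odot> i = 0"
            using c by (simp add: scale_right_distrib add.commute)
          then have "x = - (inverse c * (b + c * r)) \<odot> i"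
            unfolding scale_minus_left by (subst eq_neg_iff_add_eq_0)
          then show ?thesis by blast
        qed blast
      qed
      then obtain d where "x = d \<odot> i" by blast
      then show thesis using that[of i d] nz by simp
    next
      case False
      have "(x - r \<odot> i) \<cdot> y = a \<odot> i + b \<odot> x + c \<odot> (x \<cdot> x)"
        by (simp add: y_def bilinear unit r algebra_simps)
      then show thesis using False rel that by auto
    qed
  qed
qed

text \<open>Now \<open>i\<close> is a unit and the algebra is commutative. Without two orthogonal
  idempotents it is local: the nilpotents form an ideal complementing the line of \<open>i\<close>,
  so \<open>v\<close> and \<open>w\<close> can be shifted into it.\<close>

lemma idempotent_1_1:
  assumes p: "i \<cdot> i = i" and ind: "indep3 i v w"
    and v: "i \<cdot> v = v" "v \<cdot> i = v" and w: "i \<cdot> w = w" "w \<cdot> i = w"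
  shows classified
proof (rule ccontr)
  assume nc: "\<not> classified"
  have nz: "i \<noteq> 0" using indep3_nonzero[OF ind] by simp
  have unit: "i \<cdot> x = x" "x \<cdot> i = x" for x
    by (rule indep3_expand[OF ind, of x]; simp add: bilinear p v w)+
  have comm: "x \<cdot> y = y \<cdot> x" for x y using mul_perm[of i x y] by (simp add: unit)
  \<comment> \<open>A non-nilpotent \<open>x\<close> divides a nonzero idempotent \<open>f\<close>,
    and \<open>i - f\<close> is an idempotent orthogonal to it; hence \<open>f = i\<close> and
    \<open>x\<close> is invertible.\<close>
  have local: "\<exists>g. x \<cdot> g = i" if "x \<cdot> x \<cdot> x \<cdot> x \<noteq> 0" for x
  proof -
    from that obtain f g where f: "f \<noteq> 0" "f \<cdot> f = f" "f = x \<cdot> g"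
      using nil_or_idempotent[of x] by blast
    have "i - f = 0"
    proof (rule ccontr)
      assume "i - f \<noteq> 0"
      from two_idempotents[OF f(1) this f(2)] show False using nc by (simp add: bilinear unit f(2))
    qed
    then show ?thesis using f(3) by auto
  qed
  define M where "M = {x. x \<cdot> x \<cdot> x \<cdot> x = 0}"
  have M_mult: "x \<cdot> y \<in> M" if "x \<in> M" for x y
  proof -
    have "x \<cdot> y \<cdot> (x \<cdot> y) \<cdot> (x \<cdot> y) \<cdot> (x \<cdot> y) = (x \<cdot> x \<cdot> x \<cdot> x) \<cdot> (y \<cdot> y \<cdot> y \<cdot> y)"
      by (simp add: normed)
    then show ?thesis using that by (simp add: M_def)
  qed
  have i_notin: "i \<notin> M" using nz by (simp add: M_def p)
  have M_add: "x + y \<in> M" if "x \<in> M" "y \<in> M" for x y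
  proof (rule ccontr)
    assume "x + y \<notin> M"
    then obtain g where g: "(x + y) \<cdot> g = i" using local[of "x + y"] by (auto simp: M_def)
    define n where "n = x \<cdot> g"
    have n: "n \<cdot> n \<cdot> n \<cdot> n = 0" using M_mult[OF that(1)] by (simp add: M_def n_def)
    \<comment> \<open>The finite geometric series inverting \<open>i - n\<close>; it would make the
      nilpotent \<open>y\<close> invertible.\<close>
    define S where "S = i + n + n \<cdot> n + n \<cdot> n \<cdot> n"
    have "y \<cdot> g = i - n" unfolding g[symmetric] n_def mul_add_left by simp
    then have "y \<cdot> (g \<cdot> S) = (i - n) \<cdot> S" by (simp only: mul_assoc[symmetric])
    also have "\<dots> = i"
      unfolding S_def mul_diff mul_add_right unit mul_assoc[symmetric] n by simp
    finally show False using i_notin M_mult[OF that(2), of "g \<cdot> S"] by simp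
  qed
  \<comment> \<open>A suitable \<open>x - c \<odot> i\<close> is a zero divisor, hence not
    invertible, hence nilpotent.\<close>
  have shift: "\<exists>c. x - c \<odot> i \<in> M" for x
  proof -
    obtain c y where y: "y \<noteq> 0" "(x - c \<odot> i) \<cdot> y = 0"
      by (rule unital_zero_divisor[OF unit nz])
    have False if "(x - c \<odot> i) \<cdot> g = i" for g
    proof -
      have "y = (x - c \<odot> i) \<cdot> g \<cdot> y" by (simp only: that unit)
      also have "\<dots> = (x - c \<odot> i) \<cdot> y \<cdot> g" by (rule mul_perm)
      finally show False using y by simp
    qed
    then show ?thesis using local[of "x - c \<odot> i"] unfolding M_def by blast
  qed
  obtain c d where cd: "v - c \<odot> i \<in> M" "w - d \<odot> i \<in> M" using shift by blast
  define y where "y = v - c \<odot> i"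
  define z where "z = w - d \<odot> i"
  have ind': "indep3 i y z"
  proof (rule indep3I)
    fix k l m assume "k \<odot> i + l \<odot> y + m \<odot> z = 0"
    then have "(k - l * c - m * d) \<odot> i + l \<odot> v + m \<odot> w = 0"
      by (simp add: y_def z_def algebra_simps)
    from indep3D[OF ind this] show "k = 0 \<and> l = 0 \<and> m = 0" by simp
  qed
  have "(\<exists>x\<in>M. indep3 i x (x \<cdot> x) \<and> x \<cdot> x \<cdot> x = 0) \<or>
    y \<cdot> y = 0 \<and> y \<cdot> z = 0 \<and> z \<cdot> y = 0 \<and> z \<cdot> z = 0"
  proof (rule nil_plane[OF _ _ _ _ i_notin ind'])
    show "y \<in> M" "z \<in> M" using cd by (simp_all only: y_def z_def)
    show "k \<odot> x \<in> M" if "x \<in> M" for k x using that by (simp add: M_def mul_scale_left mul_scale_right)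
    show "x \<cdot> x \<cdot> x \<cdot> x = 0" if "x \<in> M" for x using that by (simp add: M_def)
    show "x + y \<in> M" if "x \<in> M" "y \<in> M" for x y using that by (rule M_add)
    show "x \<cdot> y \<in> M" if "x \<in> M" "y \<in> M" for x y using that(1) by (rule M_mult)
  qed
  then show False
  proof
    assume "\<exists>x\<in>M. indep3 i x (x \<cdot> x) \<and> x \<cdot> x \<cdot> x = 0"
    then obtain x where x: "indep3 i x (x \<cdot> x)" "x \<cdot> x \<cdot> x = 0" by blast
    have "x \<cdot> (x \<cdot> x) = 0" "x \<cdot> x \<cdot> (x \<cdot> x) = 0"
      by (simp_all add: mul_assoc[symmetric] x)
    then have classified by (intro classified_A10[OF x(1)]) (simp_all add: p x unit)
    then show False using nc by simp
  next
    assume "y \<cdot> y = 0 \<and> y \<cdot> z = 0 \<and> z \<cdot> y = 0 \<and> z \<cdot> z = 0"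
    then have classified by (intro classified_A09[OF ind']) (simp_all add: p unit)
    then show False using nc by simp
  qed
qed

lemma one_idempotent:
  assumes nz: "i \<noteq> 0" and p: "i \<cdot> i = i"
  shows classified
proof -
  define H where "H = {w. i \<cdot> w = w \<and> w \<cdot> i = w} \<union> {w. i \<cdot> w = 0 \<and> w \<cdot> i = w} \<union>
    {w. i \<cdot> w = 0 \<and> w \<cdot> i = 0}"
  have "x \<in> span H" for x
  proof -
    have ixi: "i \<cdot> x \<cdot> i = i \<cdot> x" using mul_perm[of i x i] by (simp add: p)
    then have mid: "i \<cdot> (x \<cdot> i) = i \<cdot> x" by (simp add: mul_assoc)
    have cancel: "i \<cdot> (i \<cdot> z) = i \<cdot> z" "z \<cdot> i \<cdot> i = z \<cdot> i" for z
      by (simp_all add: mul_assoc p) (simp add: mul_assoc[symmetric] p)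
    have "i \<cdot> x \<in> H" "x \<cdot> i - i \<cdot> x \<in> H" "x - x \<cdot> i \<in> H"
      by (simp_all add: H_def bilinear ixi cancel mid)
    then have "i \<cdot> x + (x \<cdot> i - i \<cdot> x) + (x - x \<cdot> i) \<in> span H"
      by (intro span_add span_base)
    then show ?thesis by simp
  qed
  then have H: "span H = UNIV" by blast
  obtain v where v: "v \<in> H" "\<And>a b. a \<odot> i + b \<odot> v = 0 \<Longrightarrow> a = 0 \<and> b = 0"
    using exists_indep2[OF H nz] by blast
  obtain w where w: "w \<in> H" and ind: "indep3 i v w" using exists_indep3[OF H v(2)] by blast
  note ind' = indep3_swap23[OF ind]
  show ?thesis
    \<comment> \<open>Nine ordered pairs of types reduce to six lemmas by exchanging
      \<open>v\<close> and \<open>w\<close>.\<close>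
    using v(1) w unfolding H_def
    by (elim UnE CollectE conjE)
      (use idempotent_1_1[OF p ind] idempotent_1_01[OF p ind] idempotent_1_01[OF p ind']
        idempotent_1_00[OF p ind] idempotent_1_00[OF p ind'] idempotent_01_01[OF p ind]
        idempotent_01_00[OF p ind] idempotent_01_00[OF p ind'] idempotent_00_00[OF p ind]
       in blast)+
qed

subsection \<open>Nil algebras\<close>

lemma nil_cube_nonzero:
  assumes x4: "x \<cdot> x \<cdot> x \<cdot> x = 0" and x3: "x \<cdot> x \<cdot> x \<noteq> 0"
  shows classified
proof (rule classified_A06)
  show "indep3 x (x \<cdot> x) (x \<cdot> x \<cdot> x)"
  proof (rule indep3I)
    fix a b c assume *: "a \<odot> x + b \<odot> (x \<cdot> x) + c \<odot> (x \<cdot> x \<cdot> x) = 0"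
    then have "(a \<odot> x + b \<odot> (x \<cdot> x) + c \<odot> (x \<cdot> x \<cdot> x)) \<cdot> x \<cdot> x = 0"
      "(a \<odot> x + b \<odot> (x \<cdot> x) + c \<odot> (x \<cdot> x \<cdot> x)) \<cdot> x = 0" by simp_all
    then have "a = 0" "b = 0" using x3 by (simp_all add: bilinear x4)
    then show "a = 0 \<and> b = 0 \<and> c = 0" using * x3 by simp
  qed
qed (simp_all add: mul_assoc[symmetric] x4)

text \<open>If \<open>x b b \<noteq> 0\<close> then \<open>x\<close>, \<open>x b\<close>, \<open>x b b\<close> is a basis, and expanding \<open>b\<close> in it contradicts
  \<open>b b b = 0\<close>; polarising \<open>x b b = 0\<close> in \<open>b\<close> then kills every triple product.\<close>

lemma cube_zero_imp_triple_zero: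
  assumes cube: "\<And>x. x \<cdot> x \<cdot> x = 0"
  shows "x \<cdot> y \<cdot> z = 0"
proof -
  have sq: "x \<cdot> b \<cdot> b = 0" for x b
  proof (rule ccontr)
    assume nz: "x \<cdot> b \<cdot> b \<noteq> 0"
    have b3: "z \<cdot> b \<cdot> b \<cdot> b = 0" for z using cube[of b] by (simp add: mul_assoc)
    have ind: "indep3 x (x \<cdot> b) (x \<cdot> b \<cdot> b)"
    proof (rule indep3I)
      fix k l m assume *: "k \<odot> x + l \<odot> (x \<cdot> b) + m \<odot> (x \<cdot> b \<cdot> b) = 0"
      then have "(k \<odot> x + l \<odot> (x \<cdot> b) + m \<odot> (x \<cdot> b \<cdot> b)) \<cdot> b \<cdot> b = 0"
        "(k \<odot> x + l \<odot> (x \<cdot> b) + m \<odot> (x \<cdot> b \<cdot> b)) \<cdot> b = 0" by simp_all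
      then have "k = 0" "l = 0" using nz by (simp_all add: bilinear b3)
      then show "k = 0 \<and> l = 0 \<and> m = 0" using * nz by simp
    qed
    obtain k l m where b: "b = k \<odot> x + l \<odot> (x \<cdot> b) + m \<odot> (x \<cdot> b \<cdot> b)" by (rule indep3_expand[OF ind])
    have "b \<cdot> b \<cdot> b = k \<odot> (x \<cdot> b \<cdot> b)"
      using arg_cong[OF b, of "\<lambda>t. t \<cdot> b \<cdot> b"] by (simp add: bilinear b3)
    then have "k = 0" using nz cube by simp
    \<comment> \<open>With \<open>k = 0\<close>, the expansion reads \<open>b = t \<cdot> b\<close>;
      iterating it three times brings in the cube of \<open>t\<close>, which is 0.\<close>
    define t where "t = l \<odot> x + m \<odot> (x \<cdot> b)"
    have tb: "t \<cdot> b = b" using b \<open>k = 0\<close> by (simp add: t_def bilinear)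
    have "b = t \<cdot> (t \<cdot> (t \<cdot> b))" by (simp add: tb)
    also have "\<dots> = t \<cdot> t \<cdot> t \<cdot> b" by (simp add: mul_assoc)
    finally show False using nz by (simp add: cube)
  qed
  have "x \<cdot> (y + z) \<cdot> (y + z) = x \<cdot> y \<cdot> z + x \<cdot> y \<cdot> z"
    using sq[of x y] sq[of x z] mul_perm[of x y z] by (simp add: bilinear)
  then have "(1 + 1) \<odot> (x \<cdot> y \<cdot> z) = 0" unfolding scale_left_distrib by (simp add: sq)
  then show ?thesis by simp
qed

section \<open>Nil algebras with vanishing triple products\<close>

lemma anticommutative_case:
  assumes triple: "\<And>x y z. x \<cdot> y \<cdot> z = 0" and sq: "\<And>x. x \<cdot> x = 0" and nz: "x \<cdot> y \<noteq> 0"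
  shows classified
proof (rule classified_A12[of x y "x \<cdot> y"])
  have triple': "a \<cdot> (b \<cdot> c) = 0" for a b c using triple[of a b c] by (simp add: mul_assoc)
  have "y \<cdot> x + x \<cdot> y = 0"
    using sq[of "x + y"] unfolding mul_add_left mul_add_right sq[of x] sq[of y]
    by (simp only: add_0_left add_0_right)
  then show "y \<cdot> x = - (x \<cdot> y)" by (subst eq_neg_iff_add_eq_0)
  show "indep3 x y (x \<cdot> y)"
  proof (rule indep3I)
    fix a b c assume *: "a \<odot> x + b \<odot> y + c \<odot> (x \<cdot> y) = 0"
    \<comment> \<open>Multiplying by \<open>y\<close> on the right isolates \<open>a\<close>, by
      \<open>x\<close> on the left isolates \<open>b\<close>.\<close>
    then have "(a \<odot> x + b \<odot> y + c \<odot> (x \<cdot> y)) \<cdot> y = 0" "x \<cdot> (a \<odot> x + b \<odot> y + c \<odot> (x \<cdot> y)) = 0"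
      by simp_all
    then have "a = 0" "b = 0" using nz by (simp_all add: bilinear sq triple triple')
    then show "a = 0 \<and> b = 0 \<and> c = 0" using * nz by simp
  qed
  show "x \<cdot> (x \<cdot> y) = 0" "y \<cdot> (x \<cdot> y) = 0" by (rule triple')+
qed (simp_all add: sq triple)

text \<open>All products of \<open>x\<close> and \<open>y\<close> turn out to be multiples of the
  annihilator element \<open>z\<close>, so the multiplication is a bilinear form on the plane of
  \<open>x\<close> and \<open>y\<close>. Its symmetric part is diagonalised and its rank separates
  the cases.\<close>

lemma square_nonzero_case:
  assumes triple: "\<And>x y z. x \<cdot> y \<cdot> z = 0" and nz: "x \<cdot> x \<noteq> 0"
  shows classified
proof -
  have triple': "a \<cdot> (b \<cdot> c) = 0" for a b c using triple[of a b c] by (simp add: mul_assoc)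
  define z where "z = x \<cdot> x"
  have z: "z \<cdot> t = 0" "t \<cdot> z = 0" for t by (simp_all add: z_def triple triple')
  have ind2: "a = 0 \<and> b = 0" if *: "a \<odot> x + b \<odot> z = 0" for a b
  proof -
    have "x \<cdot> (a \<odot> x + b \<odot> z) = 0" using * by simp
    then have "a = 0" using nz by (simp add: bilinear z)
    then show ?thesis using * nz by (simp add: z_def)
  qed
  obtain y where ind: "indep3 x z y" using exists_indep3[OF span_UNIV ind2] by blast
  have xy: "\<exists>k. x \<cdot> y = k \<odot> z"
  proof -
    obtain a b c where *: "x \<cdot> y = a \<odot> x + b \<odot> z + c \<odot> y" by (rule indep3_expand[OF ind])
    \<comment> \<open>Substituting the expansion into itself produces the coefficient
      \<open>c * c\<close> at \<open>y\<close>, so \<open>c = 0\<close> and then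
      \<open>a = 0\<close>.\<close>
    have "x \<cdot> (x \<cdot> y) = 0" by (rule triple')
    then have "a \<odot> z + c \<odot> (a \<odot> x + b \<odot> z + c \<odot> y) = 0"
      using * by (simp add: z_def[symmetric] bilinear z)
    then have "(c * a) \<odot> x + (a + c * b) \<odot> z + (c * c) \<odot> y = 0" by (simp add: algebra_simps)
    from indep3D[OF ind this] show ?thesis using * by auto
  qed
  have yx: "\<exists>k. y \<cdot> x = k \<odot> z"
  proof -
    obtain a b c where *: "y \<cdot> x = a \<odot> x + b \<odot> z + c \<odot> y" by (rule indep3_expand[OF ind])
    have "y \<cdot> x \<cdot> x = 0" by (rule triple)
    then have "a \<odot> z + c \<odot> (a \<odot> x + b \<odot> z + c \<odot> y) = 0"
      using * by (simp add: z_def[symmetric] bilinear z)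
    then have "(c * a) \<odot> x + (a + c * b) \<odot> z + (c * c) \<odot> y = 0" by (simp add: algebra_simps)
    from indep3D[OF ind this] show ?thesis using * by auto
  qed
  obtain k l where xy: "x \<cdot> y = k \<odot> z" and yx: "y \<cdot> x = l \<odot> z" using xy yx by blast
  have "\<exists>m. y \<cdot> y = m \<odot> z"
  proof -
    obtain a b c where *: "y \<cdot> y = a \<odot> x + b \<odot> z + c \<odot> y" by (rule indep3_expand[OF ind])
    have "y \<cdot> (y \<cdot> y) = 0" by (rule triple')
    then have "(a * l) \<odot> z + c \<odot> (a \<odot> x + b \<odot> z + c \<odot> y) = 0"
      using * by (simp add: yx bilinear z)
    then have "(c * a) \<odot> x + (a * l + c * b) \<odot> z + (c * c) \<odot> y = 0" by (simp add: algebra_simps)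
    from indep3D[OF ind this] have c: "c = 0" by simp
    have "x \<cdot> (y \<cdot> y) = 0" by (rule triple')
    then have "a \<odot> z = 0" using * c by (simp add: bilinear z z_def[symmetric])
    then have "a = 0" using nz by (simp add: z_def)
    then show ?thesis using * c by auto
  qed
  then obtain m where yy: "y \<cdot> y = m \<odot> z" by blast
  \<comment> \<open>This shift makes \<open>y'\<close> orthogonal to \<open>x\<close> for the
    symmetric part; \<open>q\<close> is what remains of the alternating part and \<open>d\<close> is
    the value of the form on \<open>y'\<close>.\<close>
  define s where "s = - (k + l) / 2"
  define y' where "y' = y + s \<odot> x"
  define q where "q = (k - l) / 2"
  define d where "d = m + s * k + s * l + s * s"
  have "x \<cdot> y' = (k + s) \<odot> z" "y' \<cdot> x = (l + s) \<odot> z"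
    by (simp_all add: y'_def bilinear xy yx z_def[symmetric] scale_left_distrib)
  moreover have "k + s = q" "l + s = - q" by (simp_all add: s_def q_def field_simps)
  ultimately have p: "x \<cdot> y' = q \<odot> z" "y' \<cdot> x = - (q \<odot> z)" by simp_all
  have yy': "y' \<cdot> y' = d \<odot> z"
    by (simp add: y'_def d_def bilinear xy yx yy z_def[symmetric] algebra_simps)
  have ind': "indep3 x z y'"
  proof (rule indep3I)
    fix a b c assume "a \<odot> x + b \<odot> z + c \<odot> y' = 0"
    then have "(a + c * s) \<odot> x + b \<odot> z + c \<odot> y = 0" by (simp add: y'_def algebra_simps)
    from indep3D[OF ind this] show "a = 0 \<and> b = 0 \<and> c = 0" by simp
  qed
  have scaled: "indep3 x z (t \<odot> y')" if "t \<noteq> 0" for t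
  proof (rule indep3I)
    fix a b c assume "a \<odot> x + b \<odot> z + c \<odot> t \<odot> y' = 0"
    then have "a \<odot> x + b \<odot> z + (c * t) \<odot> y' = 0" by simp
    from indep3D[OF ind' this] show "a = 0 \<and> b = 0 \<and> c = 0" using that by simp
  qed
  consider "d = 0" "q = 0" | "d = 0" "q \<noteq> 0" | "d \<noteq> 0" by blast
  then show ?thesis
  proof cases
    case 1
    show ?thesis
      by (rule classified_A04[OF ind']) (simp_all add: z z_def[symmetric] p yy' 1)
  next
    case 2
    then have "inverse q \<noteq> 0" by simp
    show ?thesis
      by (rule classified_A13[OF scaled[OF \<open>inverse q \<noteq> 0\<close>]])
        (simp_all add: z z_def[symmetric] p yy' 2 bilinear)
  next
    case 3
    \<comment> \<open>Normalises the square of \<open>y''\<close> to \<open>- z\<close>, so that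
      \<open>x + y''\<close> and \<open>x - y''\<close> are isotropic. Their mixed products are
      \<open>1 - r\<close> and \<open>1 + r\<close> times \<open>z + z\<close>, whence the parameter
      \<open>- r\<close>.\<close>
    define t where "t = inverse (csqrt (- d))"
    have "csqrt (- d) * csqrt (- d) = - d" by (simp add: power2_eq_square[symmetric])
    then have t: "t \<noteq> 0" "t * t * d = - 1"
      using 3 by (auto simp: t_def field_simps)
    define r where "r = t * q"
    define y'' where "y'' = t \<odot> y'"
    have P: "x \<cdot> x = z" "x \<cdot> y'' = r \<odot> z" "y'' \<cdot> x = - (r \<odot> z)" "y'' \<cdot> y'' = - z"
      using t(2) by (simp_all add: y''_def r_def z_def[symmetric] bilinear p yy' mult.assoc[symmetric])
    define u where "u = x + y''"
    define v where "v = x - y''"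
    define w where "w = z + z"
    have ind'': "indep3 u v w"
    proof (rule indep3I)
      fix a b c assume "a \<odot> u + b \<odot> v + c \<odot> w = 0"
      then have "(a + b) \<odot> x + (c + c) \<odot> z + (a - b) \<odot> (t \<odot> y') = 0"
        unfolding y''_def[symmetric] u_def v_def w_def scale_left_distrib
        by (simp add: algebra_simps)
      from indep3D[OF scaled[OF t(1)] this] show "a = 0 \<and> b = 0 \<and> c = 0" by simp
    qed
    have Q: "u \<cdot> u = 0" "v \<cdot> v = 0" "u \<cdot> v = (1 + - r) \<odot> w" "v \<cdot> u = (1 - - r) \<odot> w"
      by (simp_all only: u_def v_def bilinear P)
        (simp_all add: w_def algebra_simps)
    have W: "w \<cdot> a = 0" "a \<cdot> w = 0" for a by (simp_all add: w_def bilinear z)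
    show ?thesis
    proof (cases "r = 0")
      case True
      show ?thesis by (rule classified_A05[OF ind'']) (use Q W True in simp_all)
    next
      case False
      show ?thesis by (rule classified_A14[OF ind'', where k = "- r"]) (use Q W False in simp_all)
    qed
  qed
qed

section \<open>Assembling the cases\<close>

text \<open>The nonzero product excludes the zero multiplication; in the alternating case it
  supplies the basis for \<open>A12\<close>.\<close>

lemma classification:
  assumes "x \<cdot> y \<noteq> 0"
  shows classified
proof (cases "\<exists>i. i \<noteq> 0 \<and> i \<cdot> i = i")
  case True
  then show ?thesis using one_idempotent by blast
next
  case False
  then have x4: "x \<cdot> x \<cdot> x \<cdot> x = 0" for x using nil_or_idempotent[of x] by blast
  show ?thesis
  proof (cases "\<exists>x. x \<cdot> x \<cdot> x \<noteq> 0")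
    case True
    then show ?thesis using nil_cube_nonzero x4 by blast
  next
    case False
    then have triple: "x \<cdot> y \<cdot> z = 0" for x y z using cube_zero_imp_triple_zero by blast
    show ?thesis
      using anticommutative_case[OF triple _ assms] square_nonzero_case[OF triple] by blast
  qed
qed

end

theorem corollary12:
  fixes scale :: "complex \<Rightarrow> 'a::ab_group_add \<Rightarrow> 'a" and mul :: "'a \<Rightarrow> 'a \<Rightarrow> 'a"
  assumes "perm_algebra scale mul"
    and "vector_space.dim scale (UNIV :: 'a set) = 3"
    and "\<exists>x y. mul x y \<noteq> 0"
  shows "\<exists>B \<in> {A01, A02, A03, A04, A05, A06, A07, A08, A09, A10, A11, A12, A13} \<union>
              {A14 \<alpha> | \<alpha>. \<alpha> \<noteq> 0} \<union> {A16, A18, A21, A24}.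
           algebra_isomorphic scale mul (*s) B"
proof -
  interpret perm_algebra scale mul by (rule assms(1))
  obtain B where B: "independent B" "span B = UNIV" "card B = 3"
    using basis_exists[of UNIV] assms(2) by (metis top.extremum_unique)
  interpret perm_algebra3 scale mul B
    \<comment> \<open>\<open>B\<close> is finite because its cardinality is positive: an infinite
      set has cardinality 0.\<close>
    by unfold_locales (use B in \<open>auto intro: card_ge_0_finite\<close>)
  show ?thesis using classification assms(3) unfolding classified_def by blast
qed

end
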